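(* For every quantum channel $\mathcal{N}\colon A\to B$, the coefficients $\eta^c_{\mathrm{Tr}}(\mathcal{N})$ and $\eta^\Delta_{\mathrm{Tr}}(\mathcal{N})$ are optimized by orthogonal states, so that $$\eta^c_{\mathrm{Tr}}(\mathcal{N})=\sup_{\tau_{RA}\perp\bar\tau_{RA},\ \tau_R=\bar\tau_R}E_1(\mathcal{N}(\tau_{RA})\|\mathcal{N}(\bar\tau_{RA})),$$ $$\eta^\Delta_{\mathrm{Tr}}(\mathcal{N})=\sup_{\tau_{RA}\perp\bar\tau_{RA}}\frac{E_1(\mathcal{N}(\tau_{RA})\|\mathcal{N}(\bar\tau_{RA}))-E_1(\tau_R\|\bar\tau_R)}{1-E_1(\tau_R\|\bar\tau_R)},$$ where the suprema are over all finite-dimensional reference systems $R$ and all pairs of (possibly mixed) states of $RA$ with orthogonal supports (satisfying the indicated constraints).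
   Context: All systems are finite-dimensional. A channel on $A$ acts as the identity on $R$. $E_1(\rho\|\sigma)=\operatorname{Tr}(\rho-\sigma)_+=\frac12\|\rho-\sigma\|_1$ is the trace distance, where $(\cdot)_+$ is the positive part. All ratio optimizations are over states with strictly positive denominator, and a supremum over an empty set is $0$. The complete and conditional trace-distance contraction coefficients are $$\eta^c_{\mathrm{Tr}}(\mathcal{N})=\sup_{R,\ \rho_{RA}\neq\sigma_{RA},\ \rho_R=\sigma_R}\frac{E_1(\mathcal{N}(\rho_{RA})\|\mathcal{N}(\sigma_{RA}))}{E_1(\rho_{RA}\|\sigma_{RA})},$$ $$\eta^\Delta_{\mathrm{Tr}}(\mathcal{N})=\sup_{R,\ \rho_{RA},\sigma_{RA}}\frac{E_1(\mathcal{N}(\rho_{RA})\|\mathcal{N}(\sigma_{RA}))-E_1(\rho_R\|\sigma_R)}{E_1(\rho_{RA}\|\sigma_{RA})-E_1(\rho_R\|\sigma_R)}.$$ *)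

theory Defs
  imports "Jordan_Normal_Form.Matrix" "HOL-Library.Extended_Real"
begin

text \<open>
  A system of dimension \<open>d\<close> is the space of complex vectors of length \<open>d\<close>; operators on it are
  \<open>d\<close> by \<open>d\<close> matrices. The composite \<open>RA\<close> with \<open>dim R = r\<close>, \<open>dim A = d\<close> has dimension \<open>r * d\<close>;
  the basis vector \<open>e\<^sub>i \<otimes> e\<^sub>a\<close> has index \<open>i * d + a\<close> (for \<open>i < r\<close>, \<open>a < d\<close>).
\<close>

definition mat_trace :: "complex mat \<Rightarrow> complex" where
  "mat_trace M = (\<Sum>i<dim_row M. M $$ (i, i))"

text \<open>The order on \<^typ>\<open>complex\<close> is that of \<^theory>\<open>HOL-Library.Complex_Order\<close>: \<open>0 \<le> z\<close> says that \<open>z\<close>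
  is real and nonnegative. In particular \<open>M\<close> is Hermitian.\<close>

definition psd :: "nat \<Rightarrow> complex mat \<Rightarrow> bool" where
  "psd n M \<longleftrightarrow> M \<in> carrier_mat n n \<and> (\<forall>v\<in>carrier_vec n. 0 \<le> (M *\<^sub>v v) \<bullet>c v)"

definition state :: "nat \<Rightarrow> complex mat \<Rightarrow> bool" where
  "state n \<rho> \<longleftrightarrow> psd n \<rho> \<and> mat_trace \<rho> = 1"

text \<open>Every Hermitian \<open>H\<close> has a unique Jordan decomposition \<open>H = H\<^sub>+ - H\<^sub>-\<close> into positive
  semidefinite matrices with \<open>H\<^sub>+ H\<^sub>- = 0\<close>; the description picks out \<open>H\<^sub>+\<close>.\<close>

definition pos_part :: "complex mat \<Rightarrow> complex mat" where
  "pos_part H = (let n = dim_row H in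
     (THE P. \<exists>Q. psd n P \<and> psd n Q \<and> H = P - Q \<and> P * Q = 0\<^sub>m n n))"

definition trace_dist :: "complex mat \<Rightarrow> complex mat \<Rightarrow> real" where
  "trace_dist \<rho> \<sigma> = Re (mat_trace (pos_part (\<rho> - \<sigma>)))"

text \<open>\<open>X = \<Sum>\<^sub>i\<^sub>j E\<^sub>i\<^sub>j \<otimes> block d X i j\<close>, where \<open>E\<^sub>i\<^sub>j\<close> are the matrix units of \<open>R\<close>.\<close>

definition block :: "nat \<Rightarrow> complex mat \<Rightarrow> nat \<Rightarrow> nat \<Rightarrow> complex mat" where
  "block d X i j = mat d d (\<lambda>(a, b). X $$ (i * d + a, j * d + b))"

text \<open>The marginal on \<open>R\<close> of an operator on \<open>RA\<close>.\<close>

definition marginal_R :: "nat \<Rightarrow> nat \<Rightarrow> complex mat \<Rightarrow> complex mat" where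
  "marginal_R r d X = mat r r (\<lambda>(i, j). mat_trace (block d X i j))"

text \<open>The extension \<open>id\<^sub>R \<otimes> N\<close>, that is \<open>\<Sum>\<^sub>i\<^sub>j E\<^sub>i\<^sub>j \<otimes> X\<^sub>i\<^sub>j \<mapsto> \<Sum>\<^sub>i\<^sub>j E\<^sub>i\<^sub>j \<otimes> N X\<^sub>i\<^sub>j\<close>.\<close>

definition id_tensor ::
  "nat \<Rightarrow> nat \<Rightarrow> nat \<Rightarrow> (complex mat \<Rightarrow> complex mat) \<Rightarrow> complex mat \<Rightarrow> complex mat" where
  "id_tensor r dA dB N X = mat (r * dB) (r * dB)
     (\<lambda>(p, q). N (block dA X (p div dB) (q div dB)) $$ (p mod dB, q mod dB))"

text \<open>Completely positive trace-preserving linear maps. Only the values of \<open>N\<close> on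
  \<open>carrier_mat dA dA\<close> matter.\<close>

definition channel :: "nat \<Rightarrow> nat \<Rightarrow> (complex mat \<Rightarrow> complex mat) \<Rightarrow> bool" where
  "channel dA dB N \<longleftrightarrow>
     (\<forall>X\<in>carrier_mat dA dA. N X \<in> carrier_mat dB dB) \<and>
     (\<forall>X\<in>carrier_mat dA dA. \<forall>Y\<in>carrier_mat dA dA. N (X + Y) = N X + N Y) \<and>
     (\<forall>c. \<forall>X\<in>carrier_mat dA dA. N (c \<cdot>\<^sub>m X) = c \<cdot>\<^sub>m N X) \<and>
     (\<forall>X\<in>carrier_mat dA dA. mat_trace (N X) = mat_trace X) \<and>
     (\<forall>r X. psd (r * dA) X \<longrightarrow> psd (r * dB) (id_tensor r dA dB N X))"

text \<open>The support of a Hermitian matrix is its range.\<close>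

definition support :: "complex mat \<Rightarrow> complex vec set" where
  "support M = (\<lambda>v. M *\<^sub>v v) ` carrier_vec (dim_col M)"

definition orth_states :: "complex mat \<Rightarrow> complex mat \<Rightarrow> bool" where
  "orth_states \<tau> \<tau>' \<longleftrightarrow> (\<forall>x\<in>support \<tau>. \<forall>y\<in>support \<tau>'. x \<bullet>c y = 0)"

text \<open>Suprema are taken in \<^typ>\<open>ereal\<close>, where they always exist (no boundedness is presupposed);
  the supremum of the empty set is 0 by convention, not \<open>-\<infinity>\<close>.\<close>

definition sup0 :: "real set \<Rightarrow> ereal" where
  "sup0 S = (if S = {} then 0 else (SUP x\<in>S. ereal x))"

definition eta_c :: "nat \<Rightarrow> nat \<Rightarrow> (complex mat \<Rightarrow> complex mat) \<Rightarrow> ereal" where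
  "eta_c dA dB N = sup0
     {trace_dist (id_tensor r dA dB N \<rho>) (id_tensor r dA dB N \<sigma>) / trace_dist \<rho> \<sigma> | r \<rho> \<sigma>.
        state (r * dA) \<rho> \<and> state (r * dA) \<sigma> \<and> \<rho> \<noteq> \<sigma> \<and>
        marginal_R r dA \<rho> = marginal_R r dA \<sigma>}"

definition eta_Delta :: "nat \<Rightarrow> nat \<Rightarrow> (complex mat \<Rightarrow> complex mat) \<Rightarrow> ereal" where
  "eta_Delta dA dB N = sup0
     {(trace_dist (id_tensor r dA dB N \<rho>) (id_tensor r dA dB N \<sigma>)
         - trace_dist (marginal_R r dA \<rho>) (marginal_R r dA \<sigma>)) /
      (trace_dist \<rho> \<sigma> - trace_dist (marginal_R r dA \<rho>) (marginal_R r dA \<sigma>)) | r \<rho> \<sigma>.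
        state (r * dA) \<rho> \<and> state (r * dA) \<sigma> \<and>
        0 < trace_dist \<rho> \<sigma> - trace_dist (marginal_R r dA \<rho>) (marginal_R r dA \<sigma>)}"

end

(* Both ratios depend on the pair (rho, sigma) only through rho - sigma, up to a positive factor.
   The Jordan decomposition rho - sigma = P - Q has Tr P = Tr Q = t = E_1(rho || sigma), so
   tau = P / t and tau' = Q / t are orthogonal states with rho - sigma = t (tau - tau'). By linearity
   of the channel and of the partial trace they attain the same ratio with denominator scaled to
   E_1(tau || tau') = 1; hence the two suprema range over equal sets. *)
theory Submission
  imports Defs "Jordan_Normal_Form.Schur_Decomposition"
begin

subsection \<open>Hermitian and positive semidefinite matrices\<close>

text \<open>\<open>trace_dist\<close> goes through \<open>pos_part\<close>, a definite description,
  so nothing about it can be computed until the Jordan decomposition of a Hermitian matrix is known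
  to exist and to be unique. That is most of the work. Instead of building a full eigenbasis,
  existence peels off one eigenvector at a time, and uniqueness looks at a single eigenvector of the
  difference of two candidates; both rest on the fact that a nonzero Hermitian matrix has a nonzero
  real eigenvalue. Tr P = Tr Q because rho and sigma have the same trace, and t > 0 for rho \<noteq>
  sigma because a positive semidefinite matrix of trace zero vanishes. Strict positivity of t is
  also what carries the side conditions (equal marginals, positive denominator) over to the
  orthogonal pair. Ratios are matched pair by pair with the same reference system, so no limit or
  compactness argument is involved.\<close>

lemma cscalar_prod_sum:
  fixes v w :: "complex vec"
  assumes "w \<in> carrier_vec n"
  shows "v \<bullet>c w = (\<Sum>i<n. v $ i * cnj (w $ i))"
  using assms by (auto simp: scalar_prod_def lessThan_atLeast0 intro!: sum.cong)

lemma cscalar_prod_cnj: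
  fixes v w :: "complex vec"
  assumes "v \<in> carrier_vec n" "w \<in> carrier_vec n"
  shows "cnj (v \<bullet>c w) = w \<bullet>c v"
  unfolding cscalar_prod_sum[OF assms(1)] cscalar_prod_sum[OF assms(2)]
  by (simp add: mult.commute)

lemma cscalar_prod_linear:
  fixes v w :: "complex vec"
  assumes "v \<in> carrier_vec n" "x \<in> carrier_vec n"
  shows "w \<in> carrier_vec n \<Longrightarrow> (v + w) \<bullet>c x = v \<bullet>c x + w \<bullet>c x"
    "w \<in> carrier_vec n \<Longrightarrow> x \<bullet>c (v + w) = x \<bullet>c v + x \<bullet>c w"
    "(c \<cdot>\<^sub>v v) \<bullet>c x = c * (v \<bullet>c x)"
    "x \<bullet>c (c \<cdot>\<^sub>v v) = cnj c * (x \<bullet>c v)"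
  using assms
  by (auto simp: cscalar_prod_sum[where n = n] sum.distrib algebra_simps sum_distrib_left
      intro!: sum.cong)

lemma cscalar_prod_unit_vec:
  fixes v :: "complex vec"
  assumes "v \<in> carrier_vec n" "i < n"
  shows "v \<bullet>c unit_vec n i = v $ i"
proof -
  have "conjugate (unit_vec n i) = (unit_vec n i :: complex vec)"
    using assms by (intro eq_vecI) auto
  then show ?thesis
    using assms by simp
qed

lemma mult_mat_unit_vec:
  fixes A :: "complex mat"
  assumes "A \<in> carrier_mat n m" "j < m" "i < n"
  shows "(A *\<^sub>v unit_vec m j) $ i = A $$ (i, j)"
  using assms by simp

lemma mat_eq_0I:
  fixes A :: "complex mat"
  assumes A: "A \<in> carrier_mat n m" and 0: "\<And>v. v \<in> carrier_vec m \<Longrightarrow> A *\<^sub>v v = 0\<^sub>v n"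
  shows "A = 0\<^sub>m n m"
proof (rule eq_matI)
  fix i j assume ij: "i < dim_row (0\<^sub>m n m :: complex mat)" "j < dim_col (0\<^sub>m n m :: complex mat)"
  then have "A $$ (i, j) = (A *\<^sub>v unit_vec m j) $ i"
    using mult_mat_unit_vec[OF A] by simp
  also have "\<dots> = 0" using 0[of "unit_vec m j"] ij by simp
  finally show "A $$ (i, j) = 0\<^sub>m n m $$ (i, j)" using ij by simp
qed (use A in auto)

text \<open>Encoded entrywise to suit its two main uses: moving \<open>H\<close> across an inner
  product written as a double sum, and recognizing Tr(H H) as the sum of all |H_ij|^2.\<close>

definition hermitian :: "nat \<Rightarrow> complex mat \<Rightarrow> bool" where
  "hermitian n H \<longleftrightarrow> H \<in> carrier_mat n n \<and> (\<forall>i<n. \<forall>j<n. H $$ (i, j) = cnj (H $$ (j, i)))"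

lemma hermitianI:
  assumes "H \<in> carrier_mat n n"
    and "\<And>i j. i < n \<Longrightarrow> j < n \<Longrightarrow> H $$ (i, j) = cnj (H $$ (j, i))"
  shows "hermitian n H"
  unfolding hermitian_def using assms by blast

lemma hermitian_carrier: "hermitian n H \<Longrightarrow> H \<in> carrier_mat n n"
  by (simp add: hermitian_def)

lemma hermitian_entry: "hermitian n H \<Longrightarrow> i < n \<Longrightarrow> j < n \<Longrightarrow> cnj (H $$ (j, i)) = H $$ (i, j)"
  unfolding hermitian_def by metis

lemma mult_mat_vec_sum:
  assumes "A \<in> carrier_mat n m" "v \<in> carrier_vec m" "i < n"
  shows "(A *\<^sub>v v) $ i = (\<Sum>j<m. A $$ (i, j) * v $ j)"
  using assms by (auto simp: scalar_prod_def lessThan_atLeast0 intro!: sum.cong)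

lemma hermitian_cscalar_prod:
  assumes H: "hermitian n H" and v: "v \<in> carrier_vec n" and w: "w \<in> carrier_vec n"
  shows "(H *\<^sub>v v) \<bullet>c w = v \<bullet>c (H *\<^sub>v w)"
proof -
  have Hc: "H \<in> carrier_mat n n" using H by (rule hermitian_carrier)
  have "(H *\<^sub>v v) \<bullet>c w = (\<Sum>i<n. \<Sum>j<n. H $$ (i, j) * v $ j * cnj (w $ i))"
    by (simp add: cscalar_prod_sum[OF w] mult_mat_vec_sum[OF Hc v] sum_distrib_right
        del: index_mult_mat_vec)
  also have "\<dots> = (\<Sum>j<n. \<Sum>i<n. H $$ (i, j) * v $ j * cnj (w $ i))"
    by (rule sum.swap)
  also have "\<dots> = (\<Sum>j<n. \<Sum>i<n. v $ j * (cnj (H $$ (j, i)) * cnj (w $ i)))"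
    using hermitian_entry[OF H] by (intro sum.cong refl) (simp add: mult_ac)
  also have "\<dots> = v \<bullet>c (H *\<^sub>v w)"
    by (simp add: cscalar_prod_sum[OF mult_mat_vec_carrier[OF Hc w]] mult_mat_vec_sum[OF Hc w]
        sum_distrib_left del: index_mult_mat_vec)
  finally show ?thesis .
qed

text \<open>Polarization: a complex sesquilinear form is determined by its values on the diagonal.
  Since \<open>s\<close> is real on the diagonal, expanding it at v + w compares the imaginary parts
  of \<open>s v w\<close> and \<open>s w v\<close>, and at v + i w their real parts.\<close>

lemma psd_hermitian:
  assumes "psd n M"
  shows "hermitian n M"
proof -
  have M: "M \<in> carrier_mat n n"
    and pos: "\<And>v. v \<in> carrier_vec n \<Longrightarrow> 0 \<le> (M *\<^sub>v v) \<bullet>c v"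
    using assms by (auto simp: psd_def)
  define s where "s v w = (M *\<^sub>v v) \<bullet>c w" for v w
  have real: "Im (s v v) = 0" if "v \<in> carrier_vec n" for v
    using pos[OF that] by (simp add: s_def less_eq_complex_def)
  have pol: "s (v + z \<cdot>\<^sub>v w) (v + z \<cdot>\<^sub>v w) = s v v + z * s w v + cnj z * s v w + z * cnj z * s w w"
    if [simp]: "v \<in> carrier_vec n" "w \<in> carrier_vec n" for v w z
  proof -
    have [simp]: "M *\<^sub>v v \<in> carrier_vec n" "M *\<^sub>v w \<in> carrier_vec n"
      using M by auto
    show ?thesis
      unfolding s_def
      by (simp add: mult_add_distrib_mat_vec[OF M] mult_mat_vec[OF M]
          cscalar_prod_linear[where n = n] algebra_simps)
  qed
  have sym: "s v w = cnj (s w v)" if v: "v \<in> carrier_vec n" and w: "w \<in> carrier_vec n" for v w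
  proof -
    have "Im (s w v) + Im (s v w) = 0"
      using real[of "v + 1 \<cdot>\<^sub>v w"] pol[OF v w, of 1] real[OF v] real[OF w] v w by auto
    moreover have "Re (s w v) - Re (s v w) = 0"
      using real[of "v + \<i> \<cdot>\<^sub>v w"] pol[OF v w, of \<i>] real[OF v] real[OF w] v w by auto
    ultimately show ?thesis by (simp add: complex_eq_iff)
  qed
  have entry: "s (unit_vec n j) (unit_vec n i) = M $$ (i, j)" if "i < n" "j < n" for i j
    using that M unfolding s_def
    by (simp add: cscalar_prod_unit_vec[where n = n] mult_mat_unit_vec[OF M])
  have "M $$ (i, j) = cnj (M $$ (j, i))" if "i < n" "j < n" for i j
    using sym[of "unit_vec n j" "unit_vec n i"] entry[OF that] entry[of j i] that by simp
  with M show ?thesis by (rule hermitianI)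
qed

lemma psd_carrier: "psd n M \<Longrightarrow> M \<in> carrier_mat n n"
  by (simp add: psd_def)

lemma hermitian_minus:
  assumes "hermitian n H" "hermitian n K"
  shows "hermitian n (H - K)"
proof -
  have [simp]: "dim_row H = n" "dim_col H = n" "dim_row K = n" "dim_col K = n"
    using assms[THEN hermitian_carrier] by auto
  have "(H - K) $$ (i, j) = cnj ((H - K) $$ (j, i))" if "i < n" "j < n" for i j
    using that hermitian_entry[OF assms(1) that] hermitian_entry[OF assms(2) that] by simp
  then show ?thesis
    by (intro hermitianI) auto
qed

lemma smult_mat_mult_vec:
  fixes A :: "complex mat"
  assumes "A \<in> carrier_mat n m" "v \<in> carrier_vec m"
  shows "(c \<cdot>\<^sub>m A) *\<^sub>v v = c \<cdot>\<^sub>v (A *\<^sub>v v)"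
  using assms by (intro eq_vecI) (auto simp: scalar_prod_def sum_distrib_left mult_ac intro!: sum.cong)

lemma zero_mat_mult_vec:
  fixes v :: "complex vec"
  assumes "v \<in> carrier_vec m"
  shows "0\<^sub>m n m *\<^sub>v v = 0\<^sub>v n"
  using assms by (intro eq_vecI) (auto simp: scalar_prod_def)

lemma psd_zero: "psd n (0\<^sub>m n n)"
  by (simp add: psd_def zero_mat_mult_vec)

lemma psd_smult:
  assumes "psd n M" "0 \<le> c"
  shows "psd n (complex_of_real c \<cdot>\<^sub>m M)"
proof -
  have M: "M \<in> carrier_mat n n" using assms by (simp add: psd_def)
  have "0 \<le> (complex_of_real c \<cdot>\<^sub>m M *\<^sub>v v) \<bullet>c v" if v: "v \<in> carrier_vec n" for v
  proof -
    have "(complex_of_real c \<cdot>\<^sub>m M *\<^sub>v v) \<bullet>c v = complex_of_real c * ((M *\<^sub>v v) \<bullet>c v)"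
      using M v by (simp add: smult_mat_mult_vec[OF M v] cscalar_prod_linear[where n = n and v = "M *\<^sub>v v"])
    then show ?thesis
      using assms v by (simp add: psd_def less_eq_complex_def)
  qed
  then show ?thesis using M by (simp add: psd_def)
qed

lemma psd_add:
  assumes "psd n M" "psd n M'"
  shows "psd n (M + M')"
proof -
  have M: "M \<in> carrier_mat n n" "M' \<in> carrier_mat n n" using assms by (auto simp: psd_def)
  have "0 \<le> ((M + M') *\<^sub>v v) \<bullet>c v" if v: "v \<in> carrier_vec n" for v
    using assms v M
    by (simp add: psd_def add_mult_distrib_mat_vec[OF M v]
        cscalar_prod_linear[where n = n and v = "M *\<^sub>v v"])
  then show ?thesis using M by (simp add: psd_def)
qed

text \<open>The rank-one operator |v><v|. As v need not be a unit vector, this is ||v||^2 times the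
  projection onto v.\<close>

definition outer :: "nat \<Rightarrow> complex vec \<Rightarrow> complex mat" where
  "outer n v = mat n n (\<lambda>(i, j). v $ i * cnj (v $ j))"

lemma outer_mult_vec:
  assumes "v \<in> carrier_vec n" "x \<in> carrier_vec n"
  shows "outer n v *\<^sub>v x = (x \<bullet>c v) \<cdot>\<^sub>v v"
proof (rule eq_vecI)
  fix i assume "i < dim_vec ((x \<bullet>c v) \<cdot>\<^sub>v v)"
  then have i: "i < n" using assms by simp
  have "(outer n v *\<^sub>v x) $ i = (\<Sum>j<n. v $ i * cnj (v $ j) * x $ j)"
    using i assms by (subst mult_mat_vec_sum[where n = n and m = n]) (auto simp: outer_def)
  also have "\<dots> = (x \<bullet>c v) * v $ i"
    unfolding cscalar_prod_sum[OF assms(1)] by (simp add: sum_distrib_left sum_distrib_right mult_ac)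
  finally show "(outer n v *\<^sub>v x) $ i = ((x \<bullet>c v) \<cdot>\<^sub>v v) $ i"
    using i assms by simp
qed (use assms in \<open>auto simp: outer_def\<close>)

lemma psd_outer:
  assumes v: "v \<in> carrier_vec n"
  shows "psd n (outer n v)"
proof -
  have "0 \<le> (outer n v *\<^sub>v x) \<bullet>c x" if x: "x \<in> carrier_vec n" for x
  proof -
    have "(outer n v *\<^sub>v x) \<bullet>c x = (x \<bullet>c v) * cnj (x \<bullet>c v)"
      using v x by (simp add: outer_mult_vec cscalar_prod_cnj cscalar_prod_linear[where n = n])
    then show ?thesis by (simp add: complex_mult_cnj less_eq_complex_def)
  qed
  then show ?thesis by (simp add: psd_def outer_def)
qed

section \<open>Orthogonality of supports\<close>

lemma orth_statesD:
  assumes "orth_states P Q" "P \<in> carrier_mat n n" "Q \<in> carrier_mat n n"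
    "x \<in> carrier_vec n" "y \<in> carrier_vec n"
  shows "(P *\<^sub>v x) \<bullet>c (Q *\<^sub>v y) = 0"
  using assms by (auto simp: orth_states_def support_def)

lemma orth_statesI:
  assumes "P \<in> carrier_mat n n" "Q \<in> carrier_mat n n"
    "\<And>x y. x \<in> carrier_vec n \<Longrightarrow> y \<in> carrier_vec n \<Longrightarrow> (P *\<^sub>v x) \<bullet>c (Q *\<^sub>v y) = 0"
  shows "orth_states P Q"
  using assms by (auto simp: orth_states_def support_def)

lemma orth_states_commute:
  assumes "orth_states P Q" "P \<in> carrier_mat n n" "Q \<in> carrier_mat n n"
  shows "orth_states Q P"
proof (rule orth_statesI[OF assms(3,2)])
  fix x y :: "complex vec" assume xy: "x \<in> carrier_vec n" "y \<in> carrier_vec n"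
  have "(Q *\<^sub>v x) \<bullet>c (P *\<^sub>v y) = cnj ((P *\<^sub>v y) \<bullet>c (Q *\<^sub>v x))"
    using assms xy by (subst cscalar_prod_cnj[where n = n]) auto
  then show "(Q *\<^sub>v x) \<bullet>c (P *\<^sub>v y) = 0"
    using orth_statesD[OF assms xy(2,1)] by simp
qed

text \<open>Bridges the two notions of orthogonality: \<open>pos_part\<close> asks for a vanishing
  product, the theorem for orthogonal supports. From right to left, z = P Q y satisfies <z, z> = <Q
  y, P z>, a product of vectors from orthogonal ranges.\<close>

lemma mult_eq_0_iff_orth_states:
  assumes P: "hermitian n P" and Q: "Q \<in> carrier_mat n n"
  shows "P * Q = 0\<^sub>m n n \<longleftrightarrow> orth_states P Q"
proof -
  have Pc: "P \<in> carrier_mat n n" using P by (rule hermitian_carrier)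
  have "orth_states P Q" if 0: "P * Q = 0\<^sub>m n n"
  proof (rule orth_statesI[OF Pc Q])
    fix x y :: "complex vec" assume xy: "x \<in> carrier_vec n" "y \<in> carrier_vec n"
    have "(P *\<^sub>v x) \<bullet>c (Q *\<^sub>v y) = x \<bullet>c (P *\<^sub>v (Q *\<^sub>v y))"
      using P Q xy by (intro hermitian_cscalar_prod) auto
    also have "P *\<^sub>v (Q *\<^sub>v y) = 0\<^sub>v n"
      using 0 assoc_mult_mat_vec[OF Pc Q xy(2)] zero_mat_mult_vec[OF xy(2)] by metis
    finally show "(P *\<^sub>v x) \<bullet>c (Q *\<^sub>v y) = 0" using xy by simp
  qed
  moreover have "P * Q = 0\<^sub>m n n" if orth: "orth_states P Q"
  proof (rule mat_eq_0I)
    fix y :: "complex vec" assume y: "y \<in> carrier_vec n"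
    define z where "z = P *\<^sub>v (Q *\<^sub>v y)"
    have z: "z \<in> carrier_vec n" using Pc Q y by (simp add: z_def)
    have "z \<bullet>c z = (Q *\<^sub>v y) \<bullet>c (P *\<^sub>v z)"
      unfolding z_def using Pc Q y by (intro hermitian_cscalar_prod[OF P]) auto
    also have "\<dots> = 0"
      by (rule orth_statesD[OF orth_states_commute[OF orth Pc Q] Q Pc y z])
    finally have "z = 0\<^sub>v n"
      using z by simp
    then show "P * Q *\<^sub>v y = 0\<^sub>v n"
      unfolding z_def assoc_mult_mat_vec[OF Pc Q y] .
  qed (use Pc Q in auto)
  ultimately show ?thesis by blast
qed

subsection \<open>The Jordan decomposition of a Hermitian matrix\<close>

lemma mat_trace_mult:
  assumes "A \<in> carrier_mat n m" "B \<in> carrier_mat m n"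
  shows "mat_trace (A * B) = (\<Sum>i<n. \<Sum>j<m. A $$ (i, j) * B $$ (j, i))"
  using assms by (auto simp: mat_trace_def scalar_prod_def lessThan_atLeast0 intro!: sum.cong)

lemma mat_trace_commute:
  assumes "A \<in> carrier_mat n m" "B \<in> carrier_mat m n"
  shows "mat_trace (A * B) = mat_trace (B * A)"
  unfolding mat_trace_mult[OF assms] mat_trace_mult[OF assms(2,1)]
  by (subst sum.swap) (simp add: mult.commute)

text \<open>Tr(H H) is evaluated twice. By similarity to a triangular \<open>B\<close> it equals
  Tr(B B), which is zero if all eigenvalues are; by Hermiticity it is the sum of all |H_ij|^2, which
  is zero only for H = 0.\<close>

lemma hermitian_nonzero_eigenvector:
  assumes H: "hermitian n H" and nz: "H \<noteq> 0\<^sub>m n n"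
  obtains e v where "e \<noteq> 0" "v \<in> carrier_vec n" "v \<noteq> 0\<^sub>v n"
    "H *\<^sub>v v = complex_of_real e \<cdot>\<^sub>v v"
proof -
  have Hc: "H \<in> carrier_mat n n" using H by (rule hermitian_carrier)
  obtain es where es: "char_poly H = (\<Prod>a\<leftarrow>es. [:- a, 1:])"
    using char_poly_factorized[OF Hc] by blast
  obtain B P Q where "schur_decomposition H es = (B, P, Q)"
    by (cases "schur_decomposition H es") auto
  from schur_decomposition[OF Hc es this]
  have sim: "similar_mat_wit H B P Q" and ut: "upper_triangular B" and diag: "diag_mat B = es"
    by auto
  note w = similar_mat_witD2[OF Hc sim]
  have B[simp]: "B \<in> carrier_mat n n" and P[simp]: "P \<in> carrier_mat n n" and Q[simp]: "Q \<in> carrier_mat n n"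
    using w by auto
  have [simp]: "B * B \<in> carrier_mat n n" "B * (B * Q) \<in> carrier_mat n n" "B * Q \<in> carrier_mat n n"
    "Q * P \<in> carrier_mat n n" "B * (Q * P) \<in> carrier_mat n n"
    "P * (B * Q) \<in> carrier_mat n n" "P * B \<in> carrier_mat n n"
    by (auto intro!: mult_carrier_mat[where n = n])
  have "\<exists>e\<in>set es. e \<noteq> 0"
  proof (rule ccontr)
    assume "\<not> ?thesis"
    then have "B $$ (i, i) = 0" if "i < n" for i
      using that diag B by (force simp: diag_mat_def)
    then have B0: "B $$ (i, j) = 0" if "i < n" "j \<le> i" for i j
      using that ut B by (cases "j = i") (auto simp: upper_triangular_def)
    have "mat_trace (H * H) = mat_trace (P * (B * (B * Q)))"
    proof -
      have "H * H = P * (B * ((Q * P) * (B * Q)))"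
        unfolding w(3) by (simp add: assoc_mult_mat[where n\<^sub>1=n and n\<^sub>2=n and n\<^sub>3=n and n\<^sub>4=n])
      also have "\<dots> = P * (B * (B * Q))"
        unfolding w(2) by (simp add: left_mult_one_mat[of _ n n])
      finally show ?thesis by simp
    qed
    also have "\<dots> = mat_trace (B * (B * Q) * P)"
      by (rule mat_trace_commute[of _ n n]) auto
    also have "B * (B * Q) * P = B * B * (Q * P)"
      by (simp add: assoc_mult_mat[where n\<^sub>1=n and n\<^sub>2=n and n\<^sub>3=n and n\<^sub>4=n])
    also have "\<dots> = B * B"
      unfolding w(2) by (rule right_mult_one_mat[of _ n n]) auto
    also have "mat_trace (B * B) = 0"
      unfolding mat_trace_mult[OF B B]
    proof (intro sum.neutral ballI)
      \<comment> \<open>One of the two entries lies on or below the diagonal, where \<open>B\<close>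
        vanishes.\<close>
      fix i j assume "i \<in> {..<n}" "j \<in> {..<n}"
      then show "B $$ (i, j) * B $$ (j, i) = 0"
        using B0[of i j] B0[of j i] by (cases "j \<le> i") auto
    qed
    finally have tr0: "mat_trace (H * H) = 0" .
    have "mat_trace (H * H) = (\<Sum>i<n. \<Sum>j<n. complex_of_real ((cmod (H $$ (i, j)))\<^sup>2))"
      unfolding mat_trace_mult[OF Hc Hc]
      by (intro sum.cong refl) (simp only: complex_norm_square hermitian_entry[OF H] lessThan_iff)
    also have "\<dots> = complex_of_real (\<Sum>i<n. \<Sum>j<n. (cmod (H $$ (i, j)))\<^sup>2)"
      by simp
    finally have sum0: "(\<Sum>i<n. \<Sum>j<n. (cmod (H $$ (i, j)))\<^sup>2) = 0"
      using tr0 by (metis of_real_eq_0_iff)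
    have "H $$ (i, j) = 0" if "i < n" "j < n" for i j
    proof -
      have "\<forall>i\<in>{..<n}. (\<Sum>j<n. (cmod (H $$ (i, j)))\<^sup>2) = 0"
        using sum0 by (subst (asm) sum_nonneg_eq_0_iff) (auto intro: sum_nonneg)
      with that have "(\<Sum>j<n. (cmod (H $$ (i, j)))\<^sup>2) = 0" by auto
      then have "\<forall>j\<in>{..<n}. (cmod (H $$ (i, j)))\<^sup>2 = 0"
        by (subst (asm) sum_nonneg_eq_0_iff) auto
      with that show ?thesis by auto
    qed
    then have "H = 0\<^sub>m n n"
      using Hc by (intro eq_matI) auto
    with nz show False ..
  qed
  then obtain e where e: "e \<in> set es" "e \<noteq> 0" by blast
  have "poly (char_poly H) e = 0"
    using e(1) unfolding es by (induction es) auto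
  then have "eigenvalue H e"
    using eigenvalue_root_char_poly[OF Hc] by blast
  then obtain v where v: "v \<in> carrier_vec n" "v \<noteq> 0\<^sub>v n" "H *\<^sub>v v = e \<cdot>\<^sub>v v"
    using Hc by (auto simp: eigenvalue_def eigenvector_def)
  \<comment> \<open>The eigenvalue comes as a complex number; Hermiticity makes it real.\<close>
  have "e * (v \<bullet>c v) = (H *\<^sub>v v) \<bullet>c v"
    using v by (simp add: cscalar_prod_linear[where n = n])
  also have "\<dots> = v \<bullet>c (H *\<^sub>v v)"
    using v by (intro hermitian_cscalar_prod[OF H])
  also have "\<dots> = cnj e * (v \<bullet>c v)"
    using v by (simp add: cscalar_prod_linear[where n = n])
  finally have "e = cnj e"
    using v by simp
  then have "e = complex_of_real (Re e)"
    by (metis Reals_cnj_iff of_real_Re)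
  with e v show thesis
    using that[of "Re e" v] by (metis of_real_0)
qed

text \<open>Bounds the number of deflation steps in the Jordan decomposition.\<close>

lemma orthogonal_family_length_le:
  fixes u :: "nat \<Rightarrow> complex vec"
  assumes car: "\<And>i. i < m \<Longrightarrow> u i \<in> carrier_vec n"
    and nz: "\<And>i. i < m \<Longrightarrow> u i \<noteq> 0\<^sub>v n"
    and orth: "\<And>i j. i < m \<Longrightarrow> j < m \<Longrightarrow> i \<noteq> j \<Longrightarrow> u i \<bullet>c u j = 0"
  shows "m \<le> n"
proof (rule ccontr)
  assume "\<not> m \<le> n"
  then have mn: "n < m" by simp
  \<comment> \<open>Padding the vectors with zeros gives an invertible square matrix with a zero column.\<close>
  define A where "A = mat m m (\<lambda>(k, i). if i < n then u k $ i else 0)"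
  \<comment> \<open>Column l of \<open>C\<close> is the conjugate of u_l over its squared norm, so
    entry (k, l) of \<open>A * C\<close> is <u_k, u_l> / <u_l, u_l>.\<close>
  define C where "C = mat m m (\<lambda>(i, k). if i < n then cnj (u k $ i) / (u k \<bullet>c u k) else 0)"
  have A: "A \<in> carrier_mat m m" and C: "C \<in> carrier_mat m m"
    by (auto simp: A_def C_def)
  have "(A * C) $$ (k, l) = (u k \<bullet>c u l) / (u l \<bullet>c u l)" if kl: "k < m" "l < m" for k l
  proof -
    have "(A * C) $$ (k, l) = (\<Sum>i<m. A $$ (k, i) * C $$ (i, l))"
      using kl A C by (auto simp: scalar_prod_def lessThan_atLeast0 intro!: sum.cong)
    also have "\<dots> = (\<Sum>i<m. if i < n then u k $ i * cnj (u l $ i) / (u l \<bullet>c u l) else 0)"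
      using kl by (intro sum.cong) (auto simp: A_def C_def)
    also have "\<dots> = (\<Sum>i<n. u k $ i * cnj (u l $ i) / (u l \<bullet>c u l))"
      using mn by (intro sum.mono_neutral_cong_right) auto
    also have "\<dots> = (u k \<bullet>c u l) / (u l \<bullet>c u l)"
      using cscalar_prod_sum[OF car[OF kl(2)], of "u k"] by (simp add: sum_divide_distrib)
    finally show ?thesis .
  qed
  moreover have "u k \<bullet>c u k \<noteq> 0" if "k < m" for k
    using conjugate_square_eq_0_vec[OF car[OF that]] nz[OF that] by simp
  ultimately have "A * C = 1\<^sub>m m"
    using A C orth by (intro eq_matI) auto
  then have "C * A = 1\<^sub>m m"
    by (rule mat_mult_left_right_inverse[OF A C])
  moreover have "(C * A) $$ (n, n) = 0"
    using mn by (auto simp: A_def C_def scalar_prod_def)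
  ultimately show False using mn by simp
qed

lemma psd_minus_psd_hermitian: "psd n P \<Longrightarrow> psd n Q \<Longrightarrow> hermitian n (P - Q)"
  by (intro hermitian_minus psd_hermitian)

text \<open>Deflation: an eigenvector for a nonzero eigenvalue is orthogonal to the kernel, so
  subtracting its spectral component enlarges an orthogonal family of kernel vectors.\<close>

lemma hermitian_Jordan_decomposition_aux:
  fixes u :: "nat \<Rightarrow> complex vec"
  assumes "hermitian n H"
    and "\<And>i. i < m \<Longrightarrow> u i \<in> carrier_vec n"
    and "\<And>i. i < m \<Longrightarrow> u i \<noteq> 0\<^sub>v n"
    and "\<And>i j. i < m \<Longrightarrow> j < m \<Longrightarrow> i \<noteq> j \<Longrightarrow> u i \<bullet>c u j = 0"
    and "\<And>i. i < m \<Longrightarrow> H *\<^sub>v u i = 0\<^sub>v n"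
  shows "\<exists>P Q. psd n P \<and> psd n Q \<and> H = P - Q \<and> orth_states P Q"
  using assms
\<comment> \<open>The number m of known orthogonal kernel vectors stands in for the dimension of the
  kernel: it grows by one at each step and cannot exceed n.\<close>
proof (induction "n - m" arbitrary: m u H rule: less_induct)
  case less
  note H = less.prems(1) and car = less.prems(2) and nz = less.prems(3)
    and orth = less.prems(4) and ker = less.prems(5)
  have Hc: "H \<in> carrier_mat n n" using H by (rule hermitian_carrier)
  show ?case
  proof (cases "H = 0\<^sub>m n n")
    case True
    have "orth_states (0\<^sub>m n n) (0\<^sub>m n n)"
      by (rule orth_statesI[of _ n]) (auto simp: zero_mat_mult_vec)
    with True psd_zero[of n] show ?thesis
      by (intro exI[of _ "0\<^sub>m n n"]) auto
  next
    case False
    obtain e v where e: "e \<noteq> 0" and v: "v \<in> carrier_vec n" and v0: "v \<noteq> 0\<^sub>v n"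
      and Hv: "H *\<^sub>v v = complex_of_real e \<cdot>\<^sub>v v"
      using hermitian_nonzero_eigenvector[OF H False] .
    define N where "N = Re (v \<bullet>c v)"
    have N: "v \<bullet>c v = complex_of_real N" and Npos: "N > 0"
      using conjugate_square_greater_0_vec[OF v] v0
      by (auto simp: N_def less_complex_def complex_eq_iff)
    have vu: "v \<bullet>c u i = 0" if i: "i < m" for i
    proof -
      have "complex_of_real e * (v \<bullet>c u i) = (H *\<^sub>v v) \<bullet>c u i"
        unfolding Hv using v car[OF i] by (simp add: cscalar_prod_linear[where n = n])
      also have "\<dots> = v \<bullet>c (H *\<^sub>v u i)"
        by (rule hermitian_cscalar_prod[OF H v car[OF i]])
      also have "\<dots> = 0"
        unfolding ker[OF i] using v by simp
      finally show ?thesis using e by simp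
    qed
    then have uv: "u i \<bullet>c v = 0" if "i < m" for i
      using that cscalar_prod_cnj[OF v car[OF that]] by simp
    \<comment> \<open>Dividing by N = ||v||^2 compensates for v not being normalized: d R v = e v,
      so \<open>H'\<close> annihilates v.\<close>
    define d where "d = e / N"
    define R where "R = outer n v"
    have R: "psd n R" "R \<in> carrier_mat n n"
      using psd_outer[OF v] by (auto simp: R_def psd_carrier)
    have Rx: "R *\<^sub>v x = (x \<bullet>c v) \<cdot>\<^sub>v v" if "x \<in> carrier_vec n" for x
      unfolding R_def by (rule outer_mult_vec[OF v that])
    define H' where "H' = H - complex_of_real d \<cdot>\<^sub>m R"
    have "hermitian n (complex_of_real d \<cdot>\<^sub>m R)"
      using hermitian_entry[OF psd_hermitian[OF R(1)]] R(2) by (intro hermitianI) auto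
    then have H': "hermitian n H'" and H'c: "H' \<in> carrier_mat n n"
      using hermitian_minus[OF H] hermitian_carrier by (auto simp: H'_def)
    have H'x: "H' *\<^sub>v x = H *\<^sub>v x - (complex_of_real d * (x \<bullet>c v)) \<cdot>\<^sub>v v" if x: "x \<in> carrier_vec n" for x
      unfolding H'_def using R Hc x
      by (simp add: minus_mult_distrib_mat_vec[of _ n n] smult_mat_mult_vec[of _ n n] Rx smult_smult_assoc)
    have H'v: "H' *\<^sub>v v = 0\<^sub>v n"
      unfolding H'x[OF v] Hv N d_def using Npos v by (intro eq_vecI) auto
    have H'u: "H' *\<^sub>v u i = 0\<^sub>v n" if "i < m" for i
      unfolding H'x[OF car[OF that]] ker[OF that] uv[OF that] using v by (intro eq_vecI) auto
    define u' where "u' = u(m := v)"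
    have u': "\<And>i. i < Suc m \<Longrightarrow> u' i \<in> carrier_vec n" "\<And>i. i < Suc m \<Longrightarrow> u' i \<noteq> 0\<^sub>v n"
      "\<And>i j. i < Suc m \<Longrightarrow> j < Suc m \<Longrightarrow> i \<noteq> j \<Longrightarrow> u' i \<bullet>c u' j = 0"
      "\<And>i. i < Suc m \<Longrightarrow> H' *\<^sub>v u' i = 0\<^sub>v n"
      using car nz orth v v0 uv vu H'v H'u by (auto simp: u'_def less_Suc_eq)
    have "Suc m \<le> n"
      using u'(1-3) by (rule orthogonal_family_length_le)
    then have "n - Suc m < n - m" by simp
    from less.hyps[where m = "Suc m" and H = H' and u = u', OF this H' u'(1) u'(2) u'(3) u'(4)]
    obtain P Q where P: "psd n P" and Q: "psd n Q" and PQ: "H' = P - Q" and PoQ: "orth_states P Q"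
      by blast
    note Pc = psd_carrier[OF P] and Qc = psd_carrier[OF Q]
    \<comment> \<open>H' v = 0 says P v = Q v, and this common vector lies in two orthogonal ranges,
      so it is zero. Hence v is in both kernels.\<close>
    have PvQv: "P *\<^sub>v v = Q *\<^sub>v v"
    proof -
      have "P *\<^sub>v v - Q *\<^sub>v v = 0\<^sub>v n"
        using H'v Pc Qc v unfolding PQ by (simp add: minus_mult_distrib_mat_vec[of _ n n])
      then have "(P *\<^sub>v v - Q *\<^sub>v v) $ i = 0" if "i < n" for i using that by simp
      then show ?thesis
        using Pc Qc by (intro eq_vecI) auto
    qed
    have "(P *\<^sub>v v) \<bullet>c (P *\<^sub>v v) = 0"
      using orth_statesD[OF PoQ Pc Qc v v] PvQv by simp
    then have Pv: "P *\<^sub>v v = 0\<^sub>v n"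
      using Pc v by (subst (asm) conjugate_square_eq_0_vec[where n = n]) auto
    then have Qv: "Q *\<^sub>v v = 0\<^sub>v n" using PvQv by simp
    \<comment> \<open>If B v = 0, then v is orthogonal to the range of the Hermitian
      \<open>B\<close>, so adding a multiple of |v><v| to the other part keeps the supports
      orthogonal. Stated for general \<open>A\<close> and \<open>B\<close> so that it serves both
      signs of d.\<close>
    have shift: "orth_states (A + complex_of_real c \<cdot>\<^sub>m R) B"
      if AB: "orth_states A B" and A: "psd n A" and B: "psd n B" and Bv: "B *\<^sub>v v = 0\<^sub>v n" for A B c
    proof (rule orth_statesI)
      note Ac = psd_carrier[OF A] and Bc = psd_carrier[OF B]
      show "A + complex_of_real c \<cdot>\<^sub>m R \<in> carrier_mat n n" "B \<in> carrier_mat n n"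
        using Ac Bc R by auto
      fix x y :: "complex vec" assume x: "x \<in> carrier_vec n" and y: "y \<in> carrier_vec n"
      have By: "B *\<^sub>v y \<in> carrier_vec n" and Ax: "A *\<^sub>v x \<in> carrier_vec n" using Ac Bc x y by auto
      have "v \<bullet>c (B *\<^sub>v y) = (B *\<^sub>v v) \<bullet>c y"
        by (rule hermitian_cscalar_prod[OF psd_hermitian[OF B] v y, symmetric])
      then have vBy: "v \<bullet>c (B *\<^sub>v y) = 0" using Bv y by simp
      have "(A + complex_of_real c \<cdot>\<^sub>m R) *\<^sub>v x = A *\<^sub>v x + (complex_of_real c * (x \<bullet>c v)) \<cdot>\<^sub>v v"
        using Ac R x by (simp add: add_mult_distrib_mat_vec[of _ n n] smult_mat_mult_vec[of _ n n] Rx smult_smult_assoc)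
      then show "((A + complex_of_real c \<cdot>\<^sub>m R) *\<^sub>v x) \<bullet>c (B *\<^sub>v y) = 0"
        using orth_statesD[OF AB Ac Bc x y] vBy v By Ax
        by (simp add: cscalar_prod_linear[where n = n])
    qed
    show ?thesis
    \<comment> \<open>H = P - Q + d R: the spectral component joins the positive or the negative
      part according to the sign of the eigenvalue.\<close>
    proof (cases "d \<ge> 0")
      case True
      have "H = (P + complex_of_real d \<cdot>\<^sub>m R) - Q"
        using PQ Pc Qc R(2) Hc unfolding H'_def mat_eq_iff by (auto simp: algebra_simps)
      then show ?thesis
        using psd_add[OF P psd_smult[OF R(1) True]] Q shift[OF PoQ P Q Qv] by blast
    next
      case False
      then have d: "0 \<le> - d" by simp
      have "H = P - (Q + complex_of_real (- d) \<cdot>\<^sub>m R)"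
        using PQ Pc Qc R(2) Hc unfolding H'_def mat_eq_iff by (auto simp: algebra_simps)
      moreover have "orth_states P (Q + complex_of_real (- d) \<cdot>\<^sub>m R)"
        by (rule orth_states_commute[OF shift[OF orth_states_commute[OF PoQ Pc Qc] Q P Pv] _ Pc])
          (use Qc R in auto)
      ultimately show ?thesis
        using psd_add[OF Q psd_smult[OF R(1) d]] P by blast
    qed
  qed
qed

lemma hermitian_Jordan_decomposition:
  assumes "hermitian n H"
  obtains P Q where "psd n P" "psd n Q" "H = P - Q" "orth_states P Q"
  using hermitian_Jordan_decomposition_aux[OF assms, of 0] by auto

section \<open>Uniqueness of the Jordan decomposition\<close>

text \<open>On an eigenvector \<open>v\<close> of \<open>P - P' = Q - Q'\<close> with eigenvalue \<open>e > 0\<close>, the vectors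
  \<open>P v = P' v + e v\<close> and \<open>Q v = Q' v + e v\<close> could not be orthogonal.\<close>

lemma Jordan_decomposition_no_pos_eigenvalue:
  assumes P: "psd n P" "psd n Q" "orth_states P Q" and P': "psd n P'" "psd n Q'" "orth_states P' Q'"
    and eq: "P - Q = P' - Q'"
    and v: "v \<in> carrier_vec n" "v \<noteq> 0\<^sub>v n" and e: "(P - P') *\<^sub>v v = complex_of_real e \<cdot>\<^sub>v v"
  shows "e \<le> 0"
proof (rule ccontr)
  assume "\<not> e \<le> 0"
  then have epos: "e > 0" by simp
  have c: "P \<in> carrier_mat n n" "Q \<in> carrier_mat n n" "P' \<in> carrier_mat n n" "Q' \<in> carrier_mat n n"
    using P P' by (auto simp: psd_carrier)
  have Pv: "P *\<^sub>v v = P' *\<^sub>v v + complex_of_real e \<cdot>\<^sub>v v"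
    unfolding e[symmetric] using c v
    by (auto simp: minus_mult_distrib_mat_vec[of _ n n] simp del: index_mult_mat_vec intro!: eq_vecI)
  have QP: "Q - Q' = P - P'"
    using eq c unfolding mat_eq_iff by (auto simp: algebra_simps)
  then have Qv: "Q *\<^sub>v v = Q' *\<^sub>v v + complex_of_real e \<cdot>\<^sub>v v"
    unfolding e[symmetric] QP[symmetric] using c v
    by (auto simp: minus_mult_distrib_mat_vec[of _ n n] simp del: index_mult_mat_vec intro!: eq_vecI)
  have car: "P' *\<^sub>v v \<in> carrier_vec n" "Q' *\<^sub>v v \<in> carrier_vec n"
    using c v by auto
  \<comment> \<open>After expansion <P' v, Q' v> vanishes, the two mixed terms are nonnegative
    because e > 0, and e^2 ||v||^2 is strictly positive.\<close>
  have "0 = (P *\<^sub>v v) \<bullet>c (Q *\<^sub>v v)"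
    using orth_statesD[OF P(3) c(1,2) v(1) v(1)] by simp
  also have "\<dots> = (P' *\<^sub>v v) \<bullet>c (Q' *\<^sub>v v) + e * ((P' *\<^sub>v v) \<bullet>c v) + e * (v \<bullet>c (Q' *\<^sub>v v)) + e * e * (v \<bullet>c v)"
    unfolding Pv Qv using v car by (simp add: cscalar_prod_linear[where n = n] algebra_simps)
  also have "(P' *\<^sub>v v) \<bullet>c (Q' *\<^sub>v v) = 0"
    by (rule orth_statesD[OF P'(3) c(3,4) v(1) v(1)])
  also have "v \<bullet>c (Q' *\<^sub>v v) = (Q' *\<^sub>v v) \<bullet>c v"
    by (rule hermitian_cscalar_prod[OF psd_hermitian[OF P'(2)] v(1) v(1), symmetric])
  finally have "e * Re ((P' *\<^sub>v v) \<bullet>c v) + e * Re ((Q' *\<^sub>v v) \<bullet>c v) + e * e * Re (v \<bullet>c v) = 0"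
    by (simp add: complex_eq_iff)
  moreover have "Re ((P' *\<^sub>v v) \<bullet>c v) \<ge> 0" "Re ((Q' *\<^sub>v v) \<bullet>c v) \<ge> 0"
    using P' v by (auto simp: psd_def less_eq_complex_def)
  moreover have "Re (v \<bullet>c v) > 0"
    using conjugate_square_greater_0_vec[OF v(1)] v(2) by (simp add: less_complex_def)
  ultimately show False
    using epos by (smt (verit) mult_nonneg_nonneg mult_pos_pos)
qed

text \<open>If P - P' is nonzero it has a nonzero real eigenvalue. A positive one has just been
  excluded, and a negative one becomes positive after exchanging the two decompositions.\<close>

lemma Jordan_decomposition_unique:
  assumes P: "psd n P" "psd n Q" "orth_states P Q" and P': "psd n P'" "psd n Q'" "orth_states P' Q'"
    and eq: "P - Q = P' - Q'"
  shows "P = P'"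
proof (rule ccontr)
  assume ne: "P \<noteq> P'"
  have c: "P \<in> carrier_mat n n" "P' \<in> carrier_mat n n"
    using P P' by (auto simp: psd_carrier)
  have "P - P' \<noteq> 0\<^sub>m n n"
    using ne c unfolding mat_eq_iff by auto
  then obtain e v where e: "e \<noteq> 0" and v: "v \<in> carrier_vec n" "v \<noteq> 0\<^sub>v n"
    and ev: "(P - P') *\<^sub>v v = complex_of_real e \<cdot>\<^sub>v v"
    using hermitian_nonzero_eigenvector[OF psd_minus_psd_hermitian[OF P(1) P'(1)]] by metis
  have "(P' - P) *\<^sub>v v = - ((P - P') *\<^sub>v v)"
    using c v by (auto simp: minus_mult_distrib_mat_vec[of _ n n] simp del: index_mult_mat_vec intro!: eq_vecI)
  then have ev': "(P' - P) *\<^sub>v v = complex_of_real (- e) \<cdot>\<^sub>v v"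
    unfolding ev by (auto intro!: eq_vecI)
  show False
    using Jordan_decomposition_no_pos_eigenvalue[OF P P' eq v ev]
      Jordan_decomposition_no_pos_eigenvalue[OF P' P eq[symmetric] v ev'] e by simp
qed

text \<open>Discharges the definite description: from here on, exhibiting any orthogonal
  decomposition evaluates \<open>pos_part\<close>.\<close>

lemma pos_part_eqI:
  assumes P: "psd n P" and Q: "psd n Q" and orth: "orth_states P Q"
  shows "pos_part (P - Q) = P"
proof -
  have dim: "dim_row (P - Q) = n"
    using psd_carrier[OF Q] by simp
  have iff: "A * B = 0\<^sub>m n n \<longleftrightarrow> orth_states A B" if "psd n A" "psd n B" for A B
    using that by (intro mult_eq_0_iff_orth_states psd_hermitian psd_carrier)
  show ?thesis
    unfolding pos_part_def Let_def dim
  proof (rule the_equality)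
    show "\<exists>Q'. psd n P \<and> psd n Q' \<and> P - Q = P - Q' \<and> P * Q' = 0\<^sub>m n n"
      using assms iff by blast
    fix P' assume "\<exists>Q'. psd n P' \<and> psd n Q' \<and> P - Q = P' - Q' \<and> P' * Q' = 0\<^sub>m n n"
    then show "P' = P"
      using Jordan_decomposition_unique[OF _ _ _ P Q orth] iff by metis
  qed
qed

subsection \<open>The trace distance\<close>

lemma mat_trace_linear:
  assumes "A \<in> carrier_mat n n" "B \<in> carrier_mat n n"
  shows "mat_trace (A - B) = mat_trace A - mat_trace B"
    "mat_trace (c \<cdot>\<^sub>m A) = c * mat_trace A"
  using assms by (auto simp: mat_trace_def sum_subtractf sum_distrib_left)

lemma psd_diag_nonneg:
  assumes "psd n P" "i < n"
  shows "0 \<le> P $$ (i, i)"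
proof -
  have "0 \<le> (P *\<^sub>v unit_vec n i) \<bullet>c unit_vec n i"
    using assms(1) by (simp add: psd_def)
  also have "\<dots> = P $$ (i, i)"
    using assms(2) psd_carrier[OF assms(1)]
    by (subst cscalar_prod_unit_vec[of _ n]) (auto simp: mult_mat_unit_vec simp del: index_mult_mat_vec)
  finally show ?thesis .
qed

lemma mat_trace_psd_nonneg:
  assumes "psd n P"
  shows "0 \<le> mat_trace P"
  using psd_diag_nonneg[OF assms] psd_carrier[OF assms]
  by (auto simp: mat_trace_def intro!: sum_nonneg)

lemma psd_mat_trace_eq_0:
  assumes P: "psd n P" and tr: "mat_trace P = 0"
  shows "P = 0\<^sub>m n n"
proof -
  have c: "P \<in> carrier_mat n n" using P by (rule psd_carrier)
  have diag: "P $$ (i, i) = 0" if "i < n" for i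
  proof -
    have sum0: "(\<Sum>i<n. Re (P $$ (i, i))) = 0"
      using tr c by (simp add: mat_trace_def flip: Re_sum)
    have nonneg: "Re (P $$ (j, j)) \<ge> 0" "Im (P $$ (j, j)) = 0" if "j < n" for j
      using psd_diag_nonneg[OF P that] by (auto simp: less_eq_complex_def)
    have "Re (P $$ (i, i)) = 0"
      using sum0 nonneg(1) that by (subst (asm) sum_nonneg_eq_0_iff) auto
    with nonneg(2)[OF that] show ?thesis
      by (simp add: complex_eq_iff)
  qed
  have "P $$ (i, j) = 0" if i: "i < n" and j: "j < n" for i j
  proof -
    \<comment> \<open>Once the diagonal is zero, the quadratic form at e_i + z e_j is 2 Re (z P_ij).
      This choice of z turns it into -2 |P_ij|^2, which positivity forces to be zero.\<close>
    define z where "z = - cnj (P $$ (i, j))"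
    define e where "e k = (unit_vec n k :: complex vec)" for k
    have e: "e k \<in> carrier_vec n" for k by (simp add: e_def)
    have Pe: "P *\<^sub>v e k \<in> carrier_vec n" for k using c e by simp
    have q: "(P *\<^sub>v e k) \<bullet>c e l = P $$ (l, k)" if "k < n" "l < n" for k l
      using that Pe[of k] mult_mat_unit_vec[OF c]
      unfolding e_def by (subst cscalar_prod_unit_vec[of _ n]) auto
    have "0 \<le> (P *\<^sub>v (e i + z \<cdot>\<^sub>v e j)) \<bullet>c (e i + z \<cdot>\<^sub>v e j)"
      using P e by (simp add: psd_def)
    also have "\<dots> = P $$ (i, i) + z * P $$ (i, j) + cnj z * P $$ (j, i) + z * cnj z * P $$ (j, j)"
      using e Pe q[OF i j] q[OF j i] q[OF i i] q[OF j j]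
      by (simp add: mult_add_distrib_mat_vec[OF c] mult_mat_vec[OF c]
          cscalar_prod_linear[where n = n] algebra_simps)
    also have "\<dots> = - 2 * complex_of_real ((cmod (P $$ (i, j)))\<^sup>2)"
      unfolding z_def complex_norm_square diag[OF i] diag[OF j]
        hermitian_entry[OF psd_hermitian[OF P] j i, symmetric]
      by simp
    finally have "(cmod (P $$ (i, j)))\<^sup>2 \<le> 0"
      by (simp add: less_eq_complex_def)
    then show ?thesis by simp
  qed
  then show ?thesis using c by (intro eq_matI) auto
qed

lemma orth_states_smult:
  assumes orth: "orth_states P Q" and car: "P \<in> carrier_mat n n" "Q \<in> carrier_mat n n"
  shows "orth_states (k \<cdot>\<^sub>m P) (k \<cdot>\<^sub>m Q)"
proof (rule orth_statesI[of _ n])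
  fix x y :: "complex vec" assume xy: "x \<in> carrier_vec n" "y \<in> carrier_vec n"
  then have "P *\<^sub>v x \<in> carrier_vec n" "Q *\<^sub>v y \<in> carrier_vec n"
    using car by auto
  then show "((k \<cdot>\<^sub>m P) *\<^sub>v x) \<bullet>c ((k \<cdot>\<^sub>m Q) *\<^sub>v y) = 0"
    using orth_statesD[OF orth car xy] car xy
    by (simp add: smult_mat_mult_vec[of _ n n] cscalar_prod_linear[where n = n])
qed (use car in auto)

lemma trace_dist_nonneg:
  assumes "hermitian n (\<rho> - \<sigma>)"
  shows "0 \<le> trace_dist \<rho> \<sigma>"
  using hermitian_Jordan_decomposition[OF assms] mat_trace_psd_nonneg
  by (metis less_eq_complex_def pos_part_eqI trace_dist_def zero_complex.simps(1))

text \<open>A nonnegative multiple of a Jordan decomposition is again one, with both parts scaled. A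
  negative factor would exchange the two parts.\<close>

lemma trace_dist_scale:
  assumes H: "hermitian n (\<tau> - \<tau>')" and eq: "\<rho> - \<sigma> = complex_of_real c \<cdot>\<^sub>m (\<tau> - \<tau>')" and c: "0 \<le> c"
  shows "trace_dist \<rho> \<sigma> = c * trace_dist \<tau> \<tau>'"
proof -
  obtain P Q where P: "psd n P" and Q: "psd n Q" and PQ: "\<tau> - \<tau>' = P - Q" and orth: "orth_states P Q"
    using hermitian_Jordan_decomposition[OF H] .
  note car = psd_carrier[OF P] psd_carrier[OF Q]
  define k where "k = complex_of_real c"
  have "orth_states (k \<cdot>\<^sub>m P) (k \<cdot>\<^sub>m Q)"
    by (rule orth_states_smult[OF orth car])
  moreover have "\<rho> - \<sigma> = k \<cdot>\<^sub>m P - k \<cdot>\<^sub>m Q"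
    unfolding eq PQ k_def using car by (intro eq_matI) (auto simp: algebra_simps)
  ultimately have "pos_part (\<rho> - \<sigma>) = k \<cdot>\<^sub>m P"
    using P Q c by (simp add: k_def pos_part_eqI[of n] psd_smult)
  moreover have "pos_part (\<tau> - \<tau>') = P"
    unfolding PQ by (rule pos_part_eqI[OF P Q orth])
  ultimately show ?thesis
    using car by (simp add: trace_dist_def k_def mat_trace_linear[of _ n])
qed

lemma state_minus_hermitian: "state n \<rho> \<Longrightarrow> state n \<sigma> \<Longrightarrow> hermitian n (\<rho> - \<sigma>)"
  by (simp add: state_def psd_minus_psd_hermitian)

lemma trace_dist_self:
  assumes "psd n \<rho>"
  shows "trace_dist \<rho> \<rho> = 0"
  \<comment> \<open>The zero matrix is scaled by c = 0.\<close>
  using trace_dist_scale[of n \<rho> \<rho> \<rho> \<rho> 0] psd_carrier[OF assms] psd_minus_psd_hermitian[OF assms assms]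
  by auto

text \<open>Two orthogonal states already form the Jordan decomposition of their difference, so the
  positive part is the first state, of trace 1.\<close>

lemma trace_dist_orth_states:
  assumes "state n \<tau>" "state n \<tau>'" "orth_states \<tau> \<tau>'"
  shows "trace_dist \<tau> \<tau>' = 1"
  using assms by (simp add: trace_dist_def state_def pos_part_eqI[of n])

lemma obtain_orth_states:
  assumes \<rho>: "state n \<rho>" and \<sigma>: "state n \<sigma>" and ne: "\<rho> \<noteq> \<sigma>"
  obtains \<tau> \<tau>' where "state n \<tau>" "state n \<tau>'" "orth_states \<tau> \<tau>'" "0 < trace_dist \<rho> \<sigma>"
    "\<rho> - \<sigma> = complex_of_real (trace_dist \<rho> \<sigma>) \<cdot>\<^sub>m (\<tau> - \<tau>')"
proof -
  obtain P Q where P: "psd n P" and Q: "psd n Q" and PQ: "\<rho> - \<sigma> = P - Q" and orth: "orth_states P Q"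
    using hermitian_Jordan_decomposition[OF state_minus_hermitian[OF \<rho> \<sigma>]] .
  note car = psd_carrier[OF P] psd_carrier[OF Q]
  have car': "\<rho> \<in> carrier_mat n n" "\<sigma> \<in> carrier_mat n n"
    using \<rho> \<sigma> by (auto simp: state_def psd_carrier)
  define t where "t = trace_dist \<rho> \<sigma>"
  have "t = Re (mat_trace P)"
    using pos_part_eqI[OF P Q orth] by (simp add: t_def trace_dist_def PQ)
  then have trP: "mat_trace P = complex_of_real t"
    using mat_trace_psd_nonneg[OF P] by (simp add: less_eq_complex_def complex_eq_iff)
  \<comment> \<open>Both states have trace 1, so P - Q is traceless and Q inherits the trace t of
    P.\<close>
  have "mat_trace P - mat_trace Q = mat_trace \<rho> - mat_trace \<sigma>"
    using car car' PQ by (simp flip: mat_trace_linear(1)[of _ n])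
  then have trQ: "mat_trace Q = complex_of_real t"
    using \<rho> \<sigma> trP by (simp add: state_def)
  have "t \<noteq> 0"
  proof
    assume "t = 0"
    then have "P = 0\<^sub>m n n" "Q = 0\<^sub>m n n"
      using psd_mat_trace_eq_0 P Q trP trQ by auto
    then have "\<rho> = \<sigma>"
      using PQ car' unfolding mat_eq_iff by auto
    with ne show False ..
  qed
  moreover have "t \<ge> 0"
    using mat_trace_psd_nonneg[OF P] trP by (simp add: less_eq_complex_def)
  ultimately have t: "t > 0" by simp
  define k where "k = complex_of_real (1 / t)"
  have "state n (k \<cdot>\<^sub>m P)" "state n (k \<cdot>\<^sub>m Q)"
    using psd_smult[OF P, of "1 / t"] psd_smult[OF Q, of "1 / t"] car t trP trQ
    by (auto simp: k_def state_def mat_trace_linear[of _ n])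
  moreover have "orth_states (k \<cdot>\<^sub>m P) (k \<cdot>\<^sub>m Q)"
    by (rule orth_states_smult[OF orth car])
  moreover have "\<rho> - \<sigma> = complex_of_real t \<cdot>\<^sub>m (k \<cdot>\<^sub>m P - k \<cdot>\<^sub>m Q)"
    unfolding PQ k_def using car t by (intro eq_matI) (auto simp: algebra_simps)
  ultimately show thesis
    using that t unfolding t_def by blast
qed

subsection \<open>Channels and marginals\<close>

lemma block_index_less:
  fixes i a r d :: nat
  assumes "i < r" "a < d"
  shows "i * d + a < r * d"
proof -
  have "i * d + a < Suc i * d" using assms(2) by simp
  also have "\<dots> \<le> r * d" using assms(1) by (intro mult_right_mono) auto
  finally show ?thesis .
qed

lemma block_carrier: "block d X i j \<in> carrier_mat d d"
  by (simp add: block_def)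

lemma block_linear:
  assumes "X \<in> carrier_mat (r * d) (r * d)" "Y \<in> carrier_mat (r * d) (r * d)" "i < r" "j < r"
  shows "block d (X + Y) i j = block d X i j + block d Y i j"
    "block d (c \<cdot>\<^sub>m X) i j = c \<cdot>\<^sub>m block d X i j"
  using assms by (auto simp: block_def block_index_less intro!: eq_matI)

lemma id_tensor_carrier: "id_tensor r dA dB N X \<in> carrier_mat (r * dB) (r * dB)"
  by (simp add: id_tensor_def)

lemma id_tensor_linear:
  assumes N: "channel dA dB N"
    and X: "X \<in> carrier_mat (r * dA) (r * dA)" and Y: "Y \<in> carrier_mat (r * dA) (r * dA)"
  shows "id_tensor r dA dB N (X + Y) = id_tensor r dA dB N X + id_tensor r dA dB N Y"
    and "id_tensor r dA dB N (c \<cdot>\<^sub>m X) = c \<cdot>\<^sub>m id_tensor r dA dB N X"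
proof -
  \<comment> \<open>The case dB = 0 is allowed by the statement, but p < r * dB rules it out, so the
    remainder is a proper index.\<close>
  have idx: "p div dB < r" "p mod dB < dB" if "p < r * dB" for p
    using that by (auto simp: less_mult_imp_div_less intro!: mod_less_divisor Nat.gr0I)
  have NX: "N Z \<in> carrier_mat dB dB" if "Z \<in> carrier_mat dA dA" for Z
    using N that by (simp add: channel_def)
  have add: "N (Z + W) = N Z + N W" if "Z \<in> carrier_mat dA dA" "W \<in> carrier_mat dA dA" for Z W
    using N that by (simp add: channel_def)
  have smult: "N (c \<cdot>\<^sub>m Z) = c \<cdot>\<^sub>m N Z" if "Z \<in> carrier_mat dA dA" for Z
    using N that by (simp add: channel_def)
  have dim: "dim_row (N (block dA Z i j)) = dB" "dim_col (N (block dA Z i j)) = dB" for Z i j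
    using NX[OF block_carrier] by auto
  show "id_tensor r dA dB N (X + Y) = id_tensor r dA dB N X + id_tensor r dA dB N Y"
    using idx by (intro eq_matI)
      (auto simp: id_tensor_def block_linear[OF X Y] add[OF block_carrier block_carrier] dim)
  show "id_tensor r dA dB N (c \<cdot>\<^sub>m X) = c \<cdot>\<^sub>m id_tensor r dA dB N X"
    using idx by (intro eq_matI)
      (auto simp: id_tensor_def block_linear[OF X Y] smult[OF block_carrier] dim)
qed

lemma marginal_R_carrier: "marginal_R r d X \<in> carrier_mat r r"
  by (simp add: marginal_R_def)

lemma marginal_R_linear:
  assumes X: "X \<in> carrier_mat (r * d) (r * d)" and Y: "Y \<in> carrier_mat (r * d) (r * d)"
  shows "marginal_R r d (X + Y) = marginal_R r d X + marginal_R r d Y"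
    and "marginal_R r d (c \<cdot>\<^sub>m X) = c \<cdot>\<^sub>m marginal_R r d X"
  by (intro eq_matI; simp add: marginal_R_def block_linear[OF X Y];
      simp add: block_def mat_trace_def sum.distrib sum_distrib_left)+

text \<open>Shared by \<open>id_tensor\<close> and \<open>marginal_R\<close>, whose linearity is
  available for sums and multiples; the difference is therefore rewritten as X = Y + (c Z + (-c)
  W).\<close>

lemma linear_scaled_difference:
  assumes add: "\<And>X Y. X \<in> carrier_mat n n \<Longrightarrow> Y \<in> carrier_mat n n \<Longrightarrow> F (X + Y) = F X + (F Y :: complex mat)"
    and smult: "\<And>c X. X \<in> carrier_mat n n \<Longrightarrow> F (c \<cdot>\<^sub>m X) = c \<cdot>\<^sub>m F X"
    and car: "\<And>X. F X \<in> carrier_mat m m"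
    and X: "X \<in> carrier_mat n n" "Y \<in> carrier_mat n n" "Z \<in> carrier_mat n n" "W \<in> carrier_mat n n"
    and eq: "X - Y = c \<cdot>\<^sub>m (Z - W)"
  shows "F X - F Y = c \<cdot>\<^sub>m (F Z - F W)"
proof -
  have "X = Y + (c \<cdot>\<^sub>m Z + (- c) \<cdot>\<^sub>m W)"
    using eq X unfolding mat_eq_iff by (auto simp: algebra_simps)
  then have "F X = F Y + (c \<cdot>\<^sub>m F Z + (- c) \<cdot>\<^sub>m F W)"
    using X by (simp add: add smult)
  then show ?thesis
    using car[of Y] car[of Z] car[of W] by (auto intro!: eq_matI simp: algebra_simps)
qed

lemma marginal_R_hermitian:
  assumes H: "hermitian (r * d) H"
  shows "hermitian r (marginal_R r d H)"
proof (rule hermitianI)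
  fix i j assume "i < r" "j < r"
  then show "marginal_R r d H $$ (i, j) = cnj (marginal_R r d H $$ (j, i))"
    by (simp add: marginal_R_def mat_trace_def block_def hermitian_entry[OF H] block_index_less)
qed (simp add: marginal_R_def)

text \<open>A single orthogonal pair serves both coefficients: the distances of outputs and of
  marginals scale by the same factor, and equality of marginals is preserved.\<close>

lemma obtain_orth_states_scaled:
  assumes N: "channel dA dB N" and \<rho>: "state (r * dA) \<rho>" and \<sigma>: "state (r * dA) \<sigma>" and ne: "\<rho> \<noteq> \<sigma>"
  obtains \<tau> \<tau>' where "state (r * dA) \<tau>" "state (r * dA) \<tau>'" "orth_states \<tau> \<tau>'" "0 < trace_dist \<rho> \<sigma>"
    "trace_dist (id_tensor r dA dB N \<rho>) (id_tensor r dA dB N \<sigma>) =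
      trace_dist \<rho> \<sigma> * trace_dist (id_tensor r dA dB N \<tau>) (id_tensor r dA dB N \<tau>')"
    "trace_dist (marginal_R r dA \<rho>) (marginal_R r dA \<sigma>) =
      trace_dist \<rho> \<sigma> * trace_dist (marginal_R r dA \<tau>) (marginal_R r dA \<tau>')"
    "marginal_R r dA \<rho> = marginal_R r dA \<sigma> \<Longrightarrow> marginal_R r dA \<tau> = marginal_R r dA \<tau>'"
proof -
  obtain \<tau> \<tau>' where \<tau>: "state (r * dA) \<tau>" and \<tau>': "state (r * dA) \<tau>'" and orth: "orth_states \<tau> \<tau>'"
    and pos: "0 < trace_dist \<rho> \<sigma>"
    and eq: "\<rho> - \<sigma> = complex_of_real (trace_dist \<rho> \<sigma>) \<cdot>\<^sub>m (\<tau> - \<tau>')"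
    using obtain_orth_states[OF \<rho> \<sigma> ne] .
  have psd: "psd (r * dA) \<tau>" "psd (r * dA) \<tau>'"
    using \<tau> \<tau>' by (auto simp: state_def)
  have car: "\<rho> \<in> carrier_mat (r * dA) (r * dA)" "\<sigma> \<in> carrier_mat (r * dA) (r * dA)"
    "\<tau> \<in> carrier_mat (r * dA) (r * dA)" "\<tau>' \<in> carrier_mat (r * dA) (r * dA)"
    using \<rho> \<sigma> \<tau> \<tau>' by (auto simp: state_def psd_carrier)
  \<comment> \<open>Complete positivity enters here: the extended channel sends states to positive
    semidefinite matrices, so the output difference is Hermitian and has a Jordan
    decomposition.\<close>
  have "hermitian (r * dB) (id_tensor r dA dB N \<tau> - id_tensor r dA dB N \<tau>')"
    using N psd by (intro psd_minus_psd_hermitian) (auto simp: channel_def)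
  moreover have "id_tensor r dA dB N \<rho> - id_tensor r dA dB N \<sigma> =
      complex_of_real (trace_dist \<rho> \<sigma>) \<cdot>\<^sub>m (id_tensor r dA dB N \<tau> - id_tensor r dA dB N \<tau>')"
    by (rule linear_scaled_difference[where F = "id_tensor r dA dB N", OF _ _ id_tensor_carrier car eq])
      (simp_all add: id_tensor_linear[OF N])
  ultimately have *: "trace_dist (id_tensor r dA dB N \<rho>) (id_tensor r dA dB N \<sigma>) =
      trace_dist \<rho> \<sigma> * trace_dist (id_tensor r dA dB N \<tau>) (id_tensor r dA dB N \<tau>')"
    using pos by (intro trace_dist_scale) auto
  have m: "marginal_R r dA \<rho> - marginal_R r dA \<sigma> =
      complex_of_real (trace_dist \<rho> \<sigma>) \<cdot>\<^sub>m (marginal_R r dA \<tau> - marginal_R r dA \<tau>')"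
    by (rule linear_scaled_difference[where F = "marginal_R r dA", OF _ _ marginal_R_carrier car eq])
      (simp_all add: marginal_R_linear)
  have "hermitian r (marginal_R r dA \<tau> - marginal_R r dA \<tau>')"
    by (rule hermitian_minus[OF psd[THEN psd_hermitian, THEN marginal_R_hermitian]])
  from trace_dist_scale[OF this m] pos
  have **: "trace_dist (marginal_R r dA \<rho>) (marginal_R r dA \<sigma>) =
      trace_dist \<rho> \<sigma> * trace_dist (marginal_R r dA \<tau>) (marginal_R r dA \<tau>')"
    by simp
  have "marginal_R r dA \<tau> = marginal_R r dA \<tau>'" if "marginal_R r dA \<rho> = marginal_R r dA \<sigma>"
  proof (rule eq_matI)
    fix i j assume "i < dim_row (marginal_R r dA \<tau>')" "j < dim_col (marginal_R r dA \<tau>')"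
    then have ij: "i < r" "j < r" by (auto simp: marginal_R_def)
    have "(marginal_R r dA \<rho> - marginal_R r dA \<sigma>) $$ (i, j) = 0"
      unfolding that using ij by (simp add: marginal_R_def)
    then have "complex_of_real (trace_dist \<rho> \<sigma>) *
        (marginal_R r dA \<tau> $$ (i, j) - marginal_R r dA \<tau>' $$ (i, j)) = 0"
      unfolding m using ij by (simp add: marginal_R_def)
    then show "marginal_R r dA \<tau> $$ (i, j) = marginal_R r dA \<tau>' $$ (i, j)"
      using pos by simp
  qed (auto simp: marginal_R_def)
  with \<tau> \<tau>' orth pos * ** show thesis
    by (rule that)
qed

section \<open>Equality of the sets of ratios\<close>

theorem mainTheorem12:
  fixes dA dB :: nat and N :: "complex mat \<Rightarrow> complex mat"
  assumes "channel dA dB N"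
  shows "eta_c dA dB N = sup0
           {trace_dist (id_tensor r dA dB N \<tau>) (id_tensor r dA dB N \<tau>') | r \<tau> \<tau>'.
              state (r * dA) \<tau> \<and> state (r * dA) \<tau>' \<and> orth_states \<tau> \<tau>' \<and>
              marginal_R r dA \<tau> = marginal_R r dA \<tau>'}
       \<and> eta_Delta dA dB N = sup0
           {(trace_dist (id_tensor r dA dB N \<tau>) (id_tensor r dA dB N \<tau>')
               - trace_dist (marginal_R r dA \<tau>) (marginal_R r dA \<tau>')) /
            (1 - trace_dist (marginal_R r dA \<tau>) (marginal_R r dA \<tau>')) | r \<tau> \<tau>'.
              state (r * dA) \<tau> \<and> state (r * dA) \<tau>' \<and> orth_states \<tau> \<tau>' \<and>
              0 < 1 - trace_dist (marginal_R r dA \<tau>) (marginal_R r dA \<tau>')}"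
  (is "_ = sup0 ?C \<and> _ = sup0 ?D")
proof (intro conjI)
  let ?N = "\<lambda>r. id_tensor r dA dB N" and ?m = "\<lambda>r. marginal_R r dA"
  \<comment> \<open>Orthogonal states are at distance 1, whereas a state is at distance 0 from
    itself.\<close>
  have orth_ne: "\<tau> \<noteq> \<tau>'" if "state n \<tau>" "state n \<tau>'" "orth_states \<tau> \<tau>'" for n \<tau> \<tau>'
    using that trace_dist_orth_states[OF that] trace_dist_self[of n \<tau>] by (auto simp: state_def)
  have "{trace_dist (?N r \<rho>) (?N r \<sigma>) / trace_dist \<rho> \<sigma> | r \<rho> \<sigma>.
        state (r * dA) \<rho> \<and> state (r * dA) \<sigma> \<and> \<rho> \<noteq> \<sigma> \<and> ?m r \<rho> = ?m r \<sigma>} = ?C" (is "?L = _")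
  proof (intro equalityI subsetI)
    fix x assume "x \<in> ?L"
    then obtain r \<rho> \<sigma> where x: "x = trace_dist (?N r \<rho>) (?N r \<sigma>) / trace_dist \<rho> \<sigma>"
      and \<rho>: "state (r * dA) \<rho>" "state (r * dA) \<sigma>" "\<rho> \<noteq> \<sigma>" and m: "?m r \<rho> = ?m r \<sigma>"
      by blast
    obtain \<tau> \<tau>' where \<tau>: "state (r * dA) \<tau>" "state (r * dA) \<tau>'" "orth_states \<tau> \<tau>'"
      and "0 < trace_dist \<rho> \<sigma>"
        "trace_dist (?N r \<rho>) (?N r \<sigma>) = trace_dist \<rho> \<sigma> * trace_dist (?N r \<tau>) (?N r \<tau>')"
      and m': "?m r \<rho> = ?m r \<sigma> \<Longrightarrow> ?m r \<tau> = ?m r \<tau>'"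
      using obtain_orth_states_scaled[OF assms \<rho>] by metis
    then have "x = trace_dist (?N r \<tau>) (?N r \<tau>')"
      unfolding x by simp
    with \<tau> m'[OF m] show "x \<in> ?C" by blast
  next
    fix x assume "x \<in> ?C"
    then obtain r \<tau> \<tau>' where x: "x = trace_dist (?N r \<tau>) (?N r \<tau>')"
      and \<tau>: "state (r * dA) \<tau>" "state (r * dA) \<tau>'" "orth_states \<tau> \<tau>'" and m: "?m r \<tau> = ?m r \<tau>'"
      by blast
    have "x = trace_dist (?N r \<tau>) (?N r \<tau>') / trace_dist \<tau> \<tau>'"
      unfolding x trace_dist_orth_states[OF \<tau>] by simp
    with \<tau> m orth_ne[OF \<tau>] show "x \<in> ?L" by blast
  qed
  \<comment> \<open>As the sets themselves agree, the convention of \<open>sup0\<close> for the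
    empty set applies to both sides alike.\<close>
  then show "eta_c dA dB N = sup0 ?C"
    unfolding eta_c_def by (rule arg_cong)
  have "{(trace_dist (?N r \<rho>) (?N r \<sigma>) - trace_dist (?m r \<rho>) (?m r \<sigma>)) /
      (trace_dist \<rho> \<sigma> - trace_dist (?m r \<rho>) (?m r \<sigma>)) | r \<rho> \<sigma>.
        state (r * dA) \<rho> \<and> state (r * dA) \<sigma> \<and>
        0 < trace_dist \<rho> \<sigma> - trace_dist (?m r \<rho>) (?m r \<sigma>)} = ?D" (is "?L = _")
  proof (intro equalityI subsetI)
    fix x assume "x \<in> ?L"
    then obtain r \<rho> \<sigma> where x: "x = (trace_dist (?N r \<rho>) (?N r \<sigma>) - trace_dist (?m r \<rho>) (?m r \<sigma>)) /
        (trace_dist \<rho> \<sigma> - trace_dist (?m r \<rho>) (?m r \<sigma>))"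
      and \<rho>: "state (r * dA) \<rho>" "state (r * dA) \<sigma>"
      and pos: "0 < trace_dist \<rho> \<sigma> - trace_dist (?m r \<rho>) (?m r \<sigma>)"
      by blast
    have psd: "psd (r * dA) \<rho>" "psd (r * dA) \<sigma>"
      using \<rho> by (auto simp: state_def)
    \<comment> \<open>\<open>eta_Delta\<close> does not demand distinct states; for equal ones the
      denominator would be minus a nonnegative number, hence not positive.\<close>
    have "0 \<le> trace_dist (?m r \<rho>) (?m r \<sigma>)"
      by (rule trace_dist_nonneg[OF hermitian_minus[OF psd[THEN psd_hermitian, THEN marginal_R_hermitian]]])
    then have ne: "\<rho> \<noteq> \<sigma>"
      using pos trace_dist_self[OF psd(1)] by auto
    obtain \<tau> \<tau>' where \<tau>: "state (r * dA) \<tau>" "state (r * dA) \<tau>'" "orth_states \<tau> \<tau>'"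
      and t: "0 < trace_dist \<rho> \<sigma>"
      and eqN: "trace_dist (?N r \<rho>) (?N r \<sigma>) = trace_dist \<rho> \<sigma> * trace_dist (?N r \<tau>) (?N r \<tau>')"
      and eqm: "trace_dist (?m r \<rho>) (?m r \<sigma>) = trace_dist \<rho> \<sigma> * trace_dist (?m r \<tau>) (?m r \<tau>')"
      using obtain_orth_states_scaled[OF assms \<rho> ne] by metis
    \<comment> \<open>The factor t comes out of the whole denominator, so it cancels in the ratio
      and positivity passes to 1 minus the distance of the new marginals.\<close>
    have denom: "trace_dist \<rho> \<sigma> - trace_dist (?m r \<rho>) (?m r \<sigma>) =
        trace_dist \<rho> \<sigma> * (1 - trace_dist (?m r \<tau>) (?m r \<tau>'))"
      unfolding eqm by (simp add: algebra_simps)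
    have "x = (trace_dist (?N r \<tau>) (?N r \<tau>') - trace_dist (?m r \<tau>) (?m r \<tau>')) /
        (1 - trace_dist (?m r \<tau>) (?m r \<tau>'))"
      unfolding x denom unfolding eqN eqm using t by (simp flip: right_diff_distrib)
    moreover have "0 < 1 - trace_dist (?m r \<tau>) (?m r \<tau>')"
      using pos t unfolding denom by (simp add: zero_less_mult_iff)
    ultimately show "x \<in> ?D" using \<tau> by blast
  next
    fix x assume "x \<in> ?D"
    then obtain r \<tau> \<tau>' where x: "x = (trace_dist (?N r \<tau>) (?N r \<tau>') - trace_dist (?m r \<tau>) (?m r \<tau>')) /
        (1 - trace_dist (?m r \<tau>) (?m r \<tau>'))"
      and \<tau>: "state (r * dA) \<tau>" "state (r * dA) \<tau>'" "orth_states \<tau> \<tau>'"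
      and pos: "0 < 1 - trace_dist (?m r \<tau>) (?m r \<tau>')"
      by blast
    \<comment> \<open>Read backwards, the 1 in the denominator is the trace distance of the
      orthogonal pair, so the pair itself is admissible for \<open>eta_Delta\<close>.\<close>
    then show "x \<in> ?L"
      unfolding trace_dist_orth_states[OF \<tau>, symmetric] by blast
  qed
  then show "eta_Delta dA dB N = sup0 ?D"
    unfolding eta_Delta_def by (rule arg_cong)
qed

end
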